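(* Let $1<p<\infty$, $\alpha\in\mathbb{R}$, let $v$ be a weight function on $\mathbb{R}^2$, and let $\phi\in L^1(\mathbb{R}^2)$. Put $$\mathscr{A}_{\sup}:=\int_{\mathbb{R}^2} \frac{|\phi(t_1,t_2)|}{|t_1t_2|^{2\alpha+2-\frac1p}}\left(\sup_{(y_1,y_2)\in\mathbb{R}^2}\frac{v(t_1y_1,t_2y_2)}{v(y_1,y_2)}\right)^{1/p}dt_1dt_2,$$ $$\mathscr{A}_{\inf}:=\int_{\mathbb{R}^2} \frac{|\phi(t_1,t_2)|}{|t_1t_2|^{2\alpha+2-\frac1p}}\left(\inf_{(y_1,y_2)\in\mathbb{R}^2}\frac{v(t_1y_1,t_2y_2)}{v(y_1,y_2)}\right)^{1/p}dt_1dt_2 .$$ If there exists a function $h:\mathbb{R}^2\to[0,\infty]$ such that $v(x_1y_1,x_2y_2)=v(x_1,x_2)h(y_1,y_2)$ for all $(x_1,x_2),(y_1,y_2)\in\mathbb{R}^2$, then $\mathscr{A}_{\sup}=\mathscr{A}_{\inf}$ and $$\|\mathscr{H}_{\alpha,\phi}\|_{L^p_v(\mathbb{R}^2)\to L^p_v(\mathbb{R}^2)}=\int_{\mathbb{R}^2} \frac{|\phi(t_1,t_2)|}{|t_1t_2|^{2\alpha+2-\frac1p}}\,h^{1/p}(t_1,t_2)\,dt_1dt_2 .$$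
   Context: A weight function on $\mathbb{R}^2$ is a measurable function $v:\mathbb{R}^2\to[0,\infty]$ that is positive and finite almost everywhere. $L^p_v(\mathbb{R}^2)$ is the weighted Lebesgue space with norm $\|f\|_{L^p_v(\mathbb{R}^2)}=\left(\int_{\mathbb{R}^2}|f(x_1,x_2)|^p v(x_1,x_2)\,dx_1dx_2\right)^{1/p}$. The two dimensional Dunkl-Hausdorff operator is $$\mathscr{H}_{\alpha,\phi}f(x_1,x_2)=\int_{\mathbb{R}^2}\frac{|\phi(t_1,t_2)|}{|t_1t_2|^{2\alpha+2}}f\left(\frac{x_1}{t_1},\frac{x_2}{t_2}\right)dt_1dt_2 .$$ It is bounded on $L^p_v(\mathbb{R}^2)$ if for every $f\in L^p_v(\mathbb{R}^2)$ the integral converges absolutely for a.e. $(x_1,x_2)$ and there is a finite constant $C$ with $\|\mathscr{H}_{\alpha,\phi}f\|_{L^p_v(\mathbb{R}^2)}\le C\|f\|_{L^p_v(\mathbb{R}^2)}$ for all such $f$; the operator norm is the least such $C$, and is $\infty$ if the operator is not bounded (so the equality is in $[0,\infty]$). Since weights are positive and finite only a.e., the supremum and infimum are the essential supremum and essential infimum over $(y_1,y_2)$ (for $t_1,t_2\ne0$). Convention: $0\cdot\infty=0$. *)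

theory Defs
  imports "HOL-Analysis.Analysis" "HOL-Probability.Essential_Supremum"
begin

text \<open>The plane is \<^typ>\<open>real \<times> real\<close> with Lebesgue measure, and "measurable" means Lebesgue
  measurable. Functions in the weighted spaces take values in a scalar field \<open>'a\<close> of class
  \<^class>\<open>real_normed_field\<close> that is complete and separable, which covers \<^typ>\<open>real\<close> and
  \<^typ>\<open>complex\<close>. Values in \<open>[0,\<infinity>]\<close> are of type \<^typ>\<open>ennreal\<close>, where \<open>0 * \<infinity> = 0\<close>.\<close>

text \<open>Powers of elements of \<open>[0,\<infinity>]\<close>; only meant for exponents \<open>r > 0\<close>.\<close>

definition epowr :: "ennreal \<Rightarrow> real \<Rightarrow> ennreal" where
  "epowr x r = (if x = \<infinity> then \<infinity> else ennreal (enn2real x powr r))"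

text \<open>Dual to the library's \<^const>\<open>esssup\<close>, including the junk value for non-measurable functions.\<close>

definition essinf :: "'b measure \<Rightarrow> ('b \<Rightarrow> ennreal) \<Rightarrow> ennreal" where
  "essinf M f = (if f \<in> borel_measurable M then Liminf (ae_filter M) f else bot)"

definition weight :: "(real \<times> real \<Rightarrow> ennreal) \<Rightarrow> bool" where
  "weight v \<longleftrightarrow> v \<in> borel_measurable lebesgue \<and> (AE x in lebesgue. 0 < v x \<and> v x < \<infinity>)"

definition wLp_norm ::
    "real \<Rightarrow> (real \<times> real \<Rightarrow> ennreal) \<Rightarrow> (real \<times> real \<Rightarrow> 'a::real_normed_field) \<Rightarrow> ennreal" where
  "wLp_norm p v f = epowr (\<integral>\<^sup>+x. ennreal (norm (f x) powr p) * v x \<partial>lebesgue) (1 / p)"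

definition wLp ::
    "real \<Rightarrow> (real \<times> real \<Rightarrow> ennreal) \<Rightarrow> (real \<times> real \<Rightarrow> 'a::real_normed_field) set" where
  "wLp p v = {f \<in> borel_measurable lebesgue. wLp_norm p v f < \<infinity>}"

text \<open>The points with \<open>t\<^sub>1 t\<^sub>2 = 0\<close>, where the quotients below take the value \<open>0\<close> by convention,
  form a null set.\<close>

definition dh_integrand ::
    "real \<Rightarrow> (real \<times> real \<Rightarrow> 'a) \<Rightarrow> (real \<times> real \<Rightarrow> 'a) \<Rightarrow> real \<times> real \<Rightarrow> real \<times> real
      \<Rightarrow> 'a::real_normed_field" where
  "dh_integrand \<alpha> \<phi> f x t =
     (norm (\<phi> t) / \<bar>fst t * snd t\<bar> powr (2 * \<alpha> + 2)) *\<^sub>R f (fst x / fst t, snd x / snd t)"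

definition dunkl_hausdorff ::
    "real \<Rightarrow> (real \<times> real \<Rightarrow> 'a) \<Rightarrow> (real \<times> real \<Rightarrow> 'a) \<Rightarrow> real \<times> real
      \<Rightarrow> 'a::{real_normed_field, banach, second_countable_topology}" where
  "dunkl_hausdorff \<alpha> \<phi> f x = (\<integral>t. dh_integrand \<alpha> \<phi> f x t \<partial>lebesgue)"

text \<open>\<open>C\<close> is a bound for the operator on the weighted space. Bochner integrability is absolute
  convergence of the integral.\<close>

definition dh_bound ::
    "real \<Rightarrow> (real \<times> real \<Rightarrow> 'a::{real_normed_field, banach, second_countable_topology})
      \<Rightarrow> real \<Rightarrow> (real \<times> real \<Rightarrow> ennreal) \<Rightarrow> ennreal \<Rightarrow> bool" where
  "dh_bound \<alpha> \<phi> p v C \<longleftrightarrow>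
     (\<forall>f \<in> wLp p v. (AE x in lebesgue. integrable lebesgue (dh_integrand \<alpha> \<phi> f x)) \<and>
        wLp_norm p v (dunkl_hausdorff \<alpha> \<phi> f) \<le> C * wLp_norm p v f)"

text \<open>The infimum is \<open>\<infinity>\<close> if there is no finite bound.\<close>

definition dh_opnorm ::
    "real \<Rightarrow> (real \<times> real \<Rightarrow> 'a::{real_normed_field, banach, second_countable_topology})
      \<Rightarrow> real \<Rightarrow> (real \<times> real \<Rightarrow> ennreal) \<Rightarrow> ennreal" where
  "dh_opnorm \<alpha> \<phi> p v = Inf {C. C < \<infinity> \<and> dh_bound \<alpha> \<phi> p v C}"

definition dh_kernel ::
    "real \<Rightarrow> (real \<times> real \<Rightarrow> 'a::real_normed_field) \<Rightarrow> real \<Rightarrow> real \<times> real \<Rightarrow> ennreal" where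
  "dh_kernel \<alpha> \<phi> p t = ennreal (norm (\<phi> t) / \<bar>fst t * snd t\<bar> powr (2 * \<alpha> + 2 - 1 / p))"

definition weight_ratio ::
    "(real \<times> real \<Rightarrow> ennreal) \<Rightarrow> real \<times> real \<Rightarrow> real \<times> real \<Rightarrow> ennreal" where
  "weight_ratio v t y = v (fst t * fst y, snd t * snd y) / v y"

definition A_sup ::
    "real \<Rightarrow> (real \<times> real \<Rightarrow> 'a::real_normed_field) \<Rightarrow> real \<Rightarrow> (real \<times> real \<Rightarrow> ennreal)
      \<Rightarrow> ennreal" where
  "A_sup \<alpha> \<phi> p v =
     (\<integral>\<^sup>+t. dh_kernel \<alpha> \<phi> p t * epowr (esssup lebesgue (weight_ratio v t)) (1 / p) \<partial>lebesgue)"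

definition A_inf ::
    "real \<Rightarrow> (real \<times> real \<Rightarrow> 'a::real_normed_field) \<Rightarrow> real \<Rightarrow> (real \<times> real \<Rightarrow> ennreal)
      \<Rightarrow> ennreal" where
  "A_inf \<alpha> \<phi> p v =
     (\<integral>\<^sup>+t. dh_kernel \<alpha> \<phi> p t * epowr (essinf lebesgue (weight_ratio v t)) (1 / p) \<partial>lebesgue)"

end

theory Submission
  imports Defs
begin

text \<open>Off the coordinate axes the plane is a group under coordinatewise multiplication, with Haar measure
  \<open>dx / \<bar>x\<^sub>1 x\<^sub>2\<bar>\<close>. The functional equation makes \<open>h\<close> a homomorphism from this group to the positive reals, and
  \<open>v\<close> a constant multiple of it. So \<open>v(t y) / v(y) = h(t)\<close> for almost every \<open>y\<close>; the essential supremum and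
  infimum agree, and both constants are the integral \<open>A\<close> of
  \<open>k(t) = \<bar>\<phi>(t)\<bar> \<bar>t\<^sub>1 t\<^sub>2\<bar> powr (1 / p - 2 * \<alpha> - 2) * h(t) powr (1 / p)\<close>.

  The change of variables \<open>y = x / t\<close> shows that \<open>f \<mapsto> f(\<sqdot> / t)\<close> multiplies the weighted norm by exactly
  \<open>(\<bar>t\<^sub>1 t\<^sub>2\<bar> h(t)) powr (1 / p)\<close>. The operator is therefore an average of isometries with density \<open>k\<close>, that is,
  up to conjugation, convolution with the measure \<open>k(t) dt\<close> on the group. Minkowski's integral inequality bounds its norm
  by \<open>A\<close> (\<open>dh_bound_integral\<close>).

  That \<open>A\<close> cannot be improved (\<open>integral_le_dh_bound\<close>) is due to amenability of the group. The function
  \<open>(h(x) \<bar>x\<^sub>1 x\<^sub>2\<bar>) powr (- 1 / p)\<close> is formally an eigenfunction with eigenvalue \<open>A\<close>, but the \<open>p\<close>-th power of its norm is a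
  multiple of the Haar measure of the whole group. It is truncated to the Folner sets given by
  \<open>\<bar>ln \<bar>x\<^sub>i\<bar>\<bar> \<le> s\<close>, of Haar measure \<open>(4 s)\<^sup>2\<close>. If the integral defining the operator is restricted to
  \<open>\<bar>ln \<bar>t\<^sub>i\<bar>\<bar> \<le> r\<close>, the truncation matters only within distance \<open>r\<close> of the boundary, which is a
  negligible proportion for large \<open>s\<close>.\<close>

section \<open>Powers in the extended nonnegative reals\<close>

lemma epowr_ennreal: "0 \<le> x \<Longrightarrow> epowr (ennreal x) r = ennreal (x powr r)"
  by (simp add: epowr_def)

lemma epowr_top [simp]: "epowr top r = top"
  by (simp add: epowr_def)

lemma epowr_0 [simp]: "epowr 0 r = 0"
  by (simp add: epowr_def)

lemma epowr_1 [simp]: "epowr x 1 = x"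
  by (cases x) (simp_all add: epowr_ennreal epowr_def)

lemma epowr_mono: "x \<le> y \<Longrightarrow> 0 \<le> r \<Longrightarrow> epowr x r \<le> epowr y r"
  by (cases x; cases y)
     (auto simp: epowr_ennreal epowr_def ennreal_leI powr_mono2 top_unique)

lemma epowr_eq_0_iff [simp]: "epowr x r = 0 \<longleftrightarrow> x = 0"
  by (cases x) (auto simp: epowr_ennreal epowr_def)

lemma epowr_mult: "epowr (x * y) r = epowr x r * epowr y r"
proof -
  have *: "epowr (top * y) r = top * epowr y r" for y r
    by (cases "y = 0") simp_all
  show ?thesis
  proof (cases x)
    case x: (real a)
    show ?thesis
    proof (cases y)
      case (real b)
      with x show ?thesis
        by (simp add: epowr_ennreal powr_mult flip: ennreal_mult)
    next
      case top
      with *[of x r] show ?thesis by (simp add: mult.commute infinity_ennreal_def)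
    qed
  next
    case top
    with *[of y r] show ?thesis by (simp add: infinity_ennreal_def)
  qed
qed

lemma epowr_epowr: "epowr (epowr x r) s = epowr x (r * s)"
  by (cases x) (simp_all add: epowr_ennreal epowr_def powr_powr)

lemma epowr_add: "epowr x (r + s) = epowr x r * epowr x s"
proof (cases x)
  case (real a)
  then show ?thesis by (simp add: epowr_ennreal powr_add flip: ennreal_mult)
qed (simp add: epowr_def)

lemma epowr_eq_top_iff [simp]: "epowr x r = top \<longleftrightarrow> x = top"
  by (simp add: epowr_def)

lemma epowr_less_top_iff [simp]: "epowr x r < top \<longleftrightarrow> x < top"
  by (simp flip: less_top)

lemma measurable_epowr [measurable]:
  assumes [measurable]: "f \<in> borel_measurable M"
  shows "(\<lambda>x. epowr (f x) r) \<in> borel_measurable M"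
proof -
  have "(\<lambda>x. epowr (f x) r) = (\<lambda>x. if \<infinity> \<le> f x then \<infinity> else ennreal (enn2real (f x) powr r))"
    by (auto simp: epowr_def top_unique)
  also have "\<dots> \<in> borel_measurable M"
    by measurable
  finally show ?thesis .
qed

section \<open>Integral inequalities of Jensen and Minkowski\<close>

text \<open>For \<open>u \<ge> 0\<close> the convex function \<open>u \<mapsto> u powr p\<close> lies above its tangent at \<open>c\<close>; this is
  Young's inequality in disguise.\<close>

lemma powr_tangent:
  fixes u c p :: real
  assumes "1 < p" "0 \<le> u" "0 \<le> c"
  shows "p * c powr (p - 1) * u \<le> u powr p + (p - 1) * c powr p"
proof -
  have "u * c powr (p - 1) \<le> u powr p / p + (c powr (p - 1)) powr (p / (p - 1)) / (p / (p - 1))"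
    using assms by (intro Youngs_inequality) (auto simp: field_simps)
  also have "(c powr (p - 1)) powr (p / (p - 1)) = c powr p"
    using assms by (simp add: powr_powr)
  finally show ?thesis
    using assms by (simp add: field_simps)
qed

text \<open>Jensen's inequality for the finite measure with density \<open>k\<close>, not normalised and with values in
  \<open>[0,\<infinity>]\<close>. Integrating the tangent inequality against \<open>k\<close> bounds the integral of \<open>k * u\<close>
  for every point of tangency \<open>c\<close>. The choice \<open>c = 1\<close> shows that this integral is finite whenever the
  right-hand side is, and then the mean value of \<open>u\<close> is the optimal \<open>c\<close>.\<close>

lemma Jensen_nn_integral_powr:
  fixes k u :: "'b \<Rightarrow> ennreal"
  assumes "1 < p" and [measurable]: "k \<in> borel_measurable M" "u \<in> borel_measurable M"
    and fin: "(\<integral>\<^sup>+t. k t \<partial>M) < \<infinity>"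
  shows "epowr (\<integral>\<^sup>+t. k t * u t \<partial>M) p
    \<le> epowr (\<integral>\<^sup>+t. k t \<partial>M) (p - 1) * (\<integral>\<^sup>+t. k t * epowr (u t) p \<partial>M)"
proof -
  define A U V where "A = (\<integral>\<^sup>+t. k t \<partial>M)" and "U = (\<integral>\<^sup>+t. k t * u t \<partial>M)"
    and "V = (\<integral>\<^sup>+t. k t * epowr (u t) p \<partial>M)"
  have tangent: "ennreal (p * c powr (p - 1)) * U \<le> V + ennreal ((p - 1) * c powr p) * A"
    if "0 \<le> c" for c
  proof -
    have pointwise: "ennreal (p * c powr (p - 1)) * (k t * u t)
        \<le> k t * epowr (u t) p + ennreal ((p - 1) * c powr p) * k t" for t
    proof (cases "u t")
      case (real y)
      have "ennreal (p * c powr (p - 1)) * ennreal y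
          \<le> ennreal (y powr p) + ennreal ((p - 1) * c powr p)"
        using powr_tangent[of p y c] \<open>1 < p\<close> real that
        by (simp add: ennreal_leI flip: ennreal_mult ennreal_plus)
      from mult_left_mono[OF this, of "k t"] show ?thesis
        using real by (simp add: epowr_ennreal algebra_simps)
    next
      case top
      then show ?thesis
        by (cases "k t = 0") (auto simp: ennreal_mult_eq_top_iff ennreal_top_eq_mult_iff epowr_def ennreal_top_mult)
    qed
    have "ennreal (p * c powr (p - 1)) * U = (\<integral>\<^sup>+t. ennreal (p * c powr (p - 1)) * (k t * u t) \<partial>M)"
      unfolding U_def by (simp add: nn_integral_cmult)
    also have "\<dots> \<le> (\<integral>\<^sup>+t. k t * epowr (u t) p + ennreal ((p - 1) * c powr p) * k t \<partial>M)"
      by (intro nn_integral_mono pointwise)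
    also have "\<dots> = V + ennreal ((p - 1) * c powr p) * A"
      unfolding V_def A_def by (simp add: nn_integral_add nn_integral_cmult)
    finally show ?thesis .
  qed
  have "epowr U p \<le> epowr A (p - 1) * V"
  proof (cases "A = 0")
    case True
    then have "AE t in M. k t = 0"
      unfolding A_def by (simp add: nn_integral_0_iff_AE)
    then have "U = (\<integral>\<^sup>+t. 0 \<partial>M)"
      unfolding U_def by (intro nn_integral_cong_AE) auto
    then show ?thesis by simp
  next
    case False
    with fin obtain a where a: "A = ennreal a" "0 < a"
      unfolding A_def[symmetric] by (cases A) auto
    show ?thesis
    proof (cases "V")
      case top
      then show ?thesis
        using a by (simp add: epowr_ennreal ennreal_mult_top)
    next
      case (real b)
      have "ennreal p * U \<le> ennreal b + ennreal (p - 1) * ennreal a"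
        using tangent[of 1] real a \<open>1 < p\<close> by simp
      also have "\<dots> < \<infinity>"
        by (simp add: ennreal_mult_less_top)
      finally obtain d where d: "U = ennreal d" "0 \<le> d"
        using \<open>1 < p\<close> by (cases U) (auto simp: ennreal_mult_top)
      have "ennreal (p * (d / a) powr (p - 1) * d)
          \<le> ennreal (b + (p - 1) * (d / a) powr p * a)"
        using tangent[of "d / a"] a d real \<open>1 < p\<close>
        by (simp flip: ennreal_mult ennreal_plus)
      then have "p * (d / a) powr (p - 1) * d \<le> b + (p - 1) * (d / a) powr p * a"
        using real a d \<open>1 < p\<close> by (subst (asm) ennreal_le_iff) auto
      moreover have "(d / a) powr (p - 1) * d = (d / a) powr p * a"
        using a d by (cases "d = 0") (simp_all add: powr_diff)
      ultimately have "p * ((d / a) powr p * a) \<le> b + (p - 1) * ((d / a) powr p * a)"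
        by (simp add: mult.assoc)
      then have "(d / a) powr p * a \<le> b"
        by (simp add: left_diff_distrib)
      then have "a powr (p - 1) * ((d / a) powr p * a) \<le> a powr (p - 1) * b"
        by (intro mult_left_mono) auto
      moreover have "a powr (p - 1) * ((d / a) powr p * a) = d powr p"
        using a d by (simp add: powr_divide powr_diff)
      ultimately show ?thesis
        using a d real by (simp add: epowr_ennreal ennreal_leI flip: ennreal_mult)
    qed
  qed
  then show ?thesis
    by (simp add: A_def U_def V_def)
qed

text \<open>Minkowski's integral inequality, in the form needed for an average \<open>\<integral> k(t) G(\<sqdot>, t) dt\<close> of functions
  whose \<open>p\<close>-th power integrals are all at most \<open>D\<close>. Jensen's inequality pulls the power inside the
  average and Tonelli's theorem exchanges the integrals.\<close>

lemma Minkowski_nn_integral_powr: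
  fixes k w :: "_ \<Rightarrow> ennreal"
  assumes "1 < p" and "sigma_finite_measure M" and "sigma_finite_measure N"
    and G [measurable]: "case_prod G \<in> borel_measurable (M \<Otimes>\<^sub>M N)"
    and [measurable]: "k \<in> borel_measurable N" "w \<in> borel_measurable M"
    and fin: "(\<integral>\<^sup>+t. k t \<partial>N) < \<infinity>"
    and slice: "AE t in N. (\<integral>\<^sup>+x. epowr (G x t) p * w x \<partial>M) \<le> D"
  shows "(\<integral>\<^sup>+x. epowr (\<integral>\<^sup>+t. k t * G x t \<partial>N) p * w x \<partial>M) \<le> epowr (\<integral>\<^sup>+t. k t \<partial>N) p * D"
proof -
  interpret M: sigma_finite_measure M by fact
  interpret N: sigma_finite_measure N by fact
  interpret MN: pair_sigma_finite M N ..
  define A where "A = (\<integral>\<^sup>+t. k t \<partial>N)"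
  have Gx [measurable]: "G x \<in> borel_measurable N" if "x \<in> space M" for x
    using measurable_Pair2[OF G that] by simp
  have Gt: "(\<lambda>x. G x t) \<in> borel_measurable M" if "t \<in> space N" for t
    using measurable_Pair1[OF G that] by simp
  have "(\<integral>\<^sup>+x. epowr (\<integral>\<^sup>+t. k t * G x t \<partial>N) p * w x \<partial>M)
      \<le> (\<integral>\<^sup>+x. (epowr A (p - 1) * (\<integral>\<^sup>+t. k t * epowr (G x t) p \<partial>N)) * w x \<partial>M)"
    unfolding A_def using \<open>1 < p\<close> fin
    by (intro nn_integral_mono mult_right_mono Jensen_nn_integral_powr Gx) auto
  also have "\<dots> = (\<integral>\<^sup>+x. epowr A (p - 1) * (\<integral>\<^sup>+t. k t * (epowr (G x t) p * w x) \<partial>N) \<partial>M)"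
  proof (rule nn_integral_cong)
    fix x assume x [measurable]: "x \<in> space M"
    note [measurable] = Gx[OF x]
    show "epowr A (p - 1) * (\<integral>\<^sup>+t. k t * epowr (G x t) p \<partial>N) * w x
        = epowr A (p - 1) * (\<integral>\<^sup>+t. k t * (epowr (G x t) p * w x) \<partial>N)"
      by (simp add: mult.assoc flip: nn_integral_multc)
  qed
  also have "\<dots> = epowr A (p - 1) * (\<integral>\<^sup>+x. \<integral>\<^sup>+t. k t * (epowr (G x t) p * w x) \<partial>N \<partial>M)"
    by (intro nn_integral_cmult) measurable
  also have "(\<integral>\<^sup>+x. \<integral>\<^sup>+t. k t * (epowr (G x t) p * w x) \<partial>N \<partial>M)
      = (\<integral>\<^sup>+t. \<integral>\<^sup>+x. k t * (epowr (G x t) p * w x) \<partial>M \<partial>N)"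
    by (rule MN.Fubini'[symmetric]) measurable
  also have "\<dots> = (\<integral>\<^sup>+t. k t * (\<integral>\<^sup>+x. epowr (G x t) p * w x \<partial>M) \<partial>N)"
    by (intro nn_integral_cong nn_integral_cmult borel_measurable_times_ennreal measurable_epowr Gt) auto
  also have "\<dots> \<le> (\<integral>\<^sup>+t. k t * D \<partial>N)"
    using slice by (intro nn_integral_mono_AE) (auto elim!: eventually_mono intro: mult_left_mono)
  also have "\<dots> = A * D"
    unfolding A_def by (simp add: nn_integral_multc)
  also have "epowr A (p - 1) * (A * D) = epowr A p * D"
    using epowr_add[of A "p - 1" 1] by (simp add: mult.assoc)
  finally show ?thesis
    by (simp add: A_def mult_left_mono)
qed

lemma sigma_finite_lebesgue: "sigma_finite_measure (lebesgue :: 'a::euclidean_space measure)"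
proof
  show "\<exists>A::'a set set. countable A \<and> A \<subseteq> sets lebesgue \<and> \<Union> A = space lebesgue
      \<and> (\<forall>a\<in>A. emeasure lebesgue a \<noteq> \<infinity>)"
    by (rule exI[of _ "range (\<lambda>n::nat. cball 0 (real n))"])
       (auto simp: real_arch_simple less_imp_neq[OF emeasure_lborel_cball_finite, unfolded infinity_ennreal_def])
qed

section \<open>The multiplicative group of the plane\<close>

text \<open>The group on which everything takes place is the set of points of the plane off the coordinate
  axes, under coordinatewise multiplication; its complement is a null set.\<close>

definition off_axes :: "real \<times> real \<Rightarrow> bool" where
  "off_axes t \<longleftrightarrow> fst t * snd t \<noteq> 0"

text \<open>Division in this group. On the axes the value is determined by \<open>x / 0 = 0\<close>.\<close>

definition pdiv :: "real \<times> real \<Rightarrow> real \<times> real \<Rightarrow> real \<times> real" where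
  "pdiv x t = (fst x / fst t, snd x / snd t)"

lemma Basis_plane: "(Basis :: (real \<times> real) set) = {(1, 0), (0, 1)}"
  by (auto simp: Basis_prod_def)

lemma AE_off_axes: "AE t in lebesgue. off_axes t"
proof -
  have "negligible ({t :: real \<times> real. t \<bullet> (1, 0) = 0} \<union> {t. t \<bullet> (0, 1) = 0})"
    by (intro negligible_Un negligible_standard_hyperplane) (auto simp: Basis_plane)
  then have "AE t in lebesgue. t \<notin> {t :: real \<times> real. t \<bullet> (1, 0) = 0} \<union> {t. t \<bullet> (0, 1) = 0}"
    by (intro AE_not_in) (simp add: negligible_iff_null_sets)
  then show ?thesis
    by (rule eventually_mono) (auto simp: off_axes_def inner_prod_def)
qed

lemma measurable_lebesgue_borel [measurable (raw)]:
  "g \<in> borel_measurable borel \<Longrightarrow> g \<in> borel_measurable lebesgue"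
  by (simp add: measurable_completion)

lemma coordinate_product_measurable [measurable]:
  "(\<lambda>t::real\<times>real. fst t * snd t) \<in> borel_measurable lebesgue"
  by (intro measurable_lebesgue_borel borel_measurable_continuous_onI continuous_intros)

lemma pdiv_right_scaling:
  assumes "off_axes t"
  shows pdiv_right_measurable: "(\<lambda>x. pdiv x t) \<in> lebesgue \<rightarrow>\<^sub>M lebesgue"
    and nn_integral_pdiv: "F \<in> borel_measurable lebesgue \<Longrightarrow> (\<integral>\<^sup>+x. F (pdiv x t) \<partial>lebesgue) = ennreal \<bar>fst t * snd t\<bar> * (\<integral>\<^sup>+x. F x \<partial>lebesgue)"
proof -
  define c :: "real \<times> real \<Rightarrow> real" where "c j = (if j = (1, 0) then 1 / fst t else 1 / snd t)" for j
  have T: "(\<lambda>x. 0 + (\<Sum>j\<in>Basis. (c j * (x \<bullet> j)) *\<^sub>R j)) = (\<lambda>x. pdiv x t)"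
    by (auto simp: Basis_plane c_def pdiv_def inner_prod_def)
  have c: "c j \<noteq> 0" if "j \<in> Basis" for j
    using assms(1) by (auto simp: c_def off_axes_def)
  show *[measurable]: "(\<lambda>x. pdiv x t) \<in> lebesgue \<rightarrow>\<^sub>M lebesgue"
    using lebesgue_affine_measurable[of c 0, OF c] unfolding T by simp
  have J: "(\<Prod>j\<in>Basis. \<bar>c j\<bar>) = 1 / \<bar>fst t * snd t\<bar>"
    by (simp add: Basis_plane c_def abs_mult)
  assume F [measurable]: "F \<in> borel_measurable lebesgue"
  have "(\<integral>\<^sup>+x. F x \<partial>lebesgue)
      = (\<integral>\<^sup>+x. F x \<partial>density (distr lebesgue lebesgue (\<lambda>x. pdiv x t)) (\<lambda>_. ennreal (1 / \<bar>fst t * snd t\<bar>)))"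
    using lebesgue_affine_euclidean[of c 0, OF c] unfolding T J by simp
  also have "\<dots> = ennreal (1 / \<bar>fst t * snd t\<bar>) * (\<integral>\<^sup>+x. F (pdiv x t) \<partial>lebesgue)"
    by (subst nn_integral_density) (auto simp: nn_integral_distr nn_integral_cmult)
  finally have "ennreal \<bar>fst t * snd t\<bar> * (\<integral>\<^sup>+x. F x \<partial>lebesgue)
      = (ennreal \<bar>fst t * snd t\<bar> * ennreal (1 / \<bar>fst t * snd t\<bar>)) * (\<integral>\<^sup>+x. F (pdiv x t) \<partial>lebesgue)"
    by (simp add: mult.assoc)
  also have "ennreal \<bar>fst t * snd t\<bar> * ennreal (1 / \<bar>fst t * snd t\<bar>) = 1"
    using assms(1) by (simp add: off_axes_def flip: ennreal_mult)
  finally show "(\<integral>\<^sup>+x. F (pdiv x t) \<partial>lebesgue) = ennreal \<bar>fst t * snd t\<bar> * (\<integral>\<^sup>+x. F x \<partial>lebesgue)"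
    by simp
qed

lemma pdiv_borel [measurable (raw)]:
  assumes "f \<in> borel_measurable M" "g \<in> borel_measurable M"
  shows "(\<lambda>x. pdiv (f x) (g x)) \<in> borel_measurable M"
proof -
  have fs: "fst \<in> borel_measurable (borel :: (real \<times> real) measure)"
      "snd \<in> borel_measurable (borel :: (real \<times> real) measure)"
    by (auto intro!: borel_measurable_continuous_onI continuous_intros)
  note [measurable] = assms measurable_compose[OF assms(1) fs(1)] measurable_compose[OF assms(1) fs(2)]
    measurable_compose[OF assms(2) fs(1)] measurable_compose[OF assms(2) fs(2)]
  show ?thesis
    unfolding pdiv_def by measurable
qed

text \<open>Off the axes \<open>t \<mapsto> x / t\<close> is a differentiable involution, so it maps null sets to null sets. Hence
  changing \<open>f\<close> on a null set affects \<open>t \<mapsto> f(x / t)\<close> only on a null set, and (next lemma) composition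
  with this map preserves Lebesgue measurability.\<close>

lemma AE_pdiv_left:
  assumes x: "off_axes x" and P: "AE y in lebesgue. P y"
  shows "AE t in lebesgue. P (pdiv x t)"
proof -
  let ?N = "{y. \<not> P y} \<inter> {y. off_axes y}"
  have "negligible {y. \<not> P y}"
    using P by (simp add: completion.AE_iff_null_sets negligible_iff_null_sets)
  then have neg: "negligible ?N"
    by (rule negligible_subset) auto
  have "(\<lambda>t. pdiv x t) differentiable_on ?N"
    unfolding differentiable_on_def pdiv_def
    by (intro ballI differentiable_Pair differentiable_divide differentiable_const
        bounded_linear_imp_differentiable bounded_linear_fst bounded_linear_snd)
      (auto simp: off_axes_def)
  then have "negligible ((\<lambda>t. pdiv x t) ` ?N)"
    using neg by (intro negligible_differentiable_image_negligible) auto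
  then have "AE t in lebesgue. t \<notin> (\<lambda>t. pdiv x t) ` ?N"
    by (intro AE_not_in) (simp add: negligible_iff_null_sets)
  then show ?thesis
    using AE_off_axes
  proof eventually_elim
    case (elim t)
    have "t = pdiv x (pdiv x t)" "off_axes (pdiv x t)"
      using x elim by (auto simp: pdiv_def off_axes_def)
    with elim show ?case
      by blast
  qed
qed

lemma pdiv_left_measurable:
  assumes x: "off_axes x"
  shows "(\<lambda>t. pdiv x t) \<in> lebesgue \<rightarrow>\<^sub>M lebesgue"
proof (rule completion.measurable_completion2)
  show T [measurable]: "(\<lambda>t. pdiv x t) \<in> lebesgue \<rightarrow>\<^sub>M lborel"
    by simp
  show "null_sets lborel \<subseteq> null_sets (distr lebesgue lborel (\<lambda>t. pdiv x t))"
  proof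
    fix N :: "(real \<times> real) set" assume N: "N \<in> null_sets lborel"
    then have "AE y in lebesgue. y \<notin> N"
      by (intro AE_not_in null_sets_completionI)
    then have "{t. pdiv x t \<in> N} \<in> null_sets lebesgue"
      using AE_pdiv_left[OF x, of "\<lambda>y. y \<notin> N"] by (simp add: completion.AE_iff_null_sets)
    then show "N \<in> null_sets (distr lebesgue lborel (\<lambda>t. pdiv x t))"
      using N by (auto simp: null_sets_def emeasure_distr vimage_def)
  qed
qed

section \<open>Multiplicative weights\<close>

text \<open>The functional equation forces \<open>v = v(1,1) h\<close> with \<open>0 < v(1,1) < \<infinity>\<close>, and \<open>h\<close> to be a homomorphism
  from the group off the axes to the positive reals.\<close>

locale multiplicative_weight =
  fixes v h :: "real \<times> real \<Rightarrow> ennreal"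
  assumes weight: "weight v"
    and mult: "\<And>x1 x2 y1 y2. v (x1 * y1, x2 * y2) = v (x1, x2) * h (y1, y2)"
begin

abbreviation "c \<equiv> v (1, 1)"

lemma weight_measurable [measurable]: "v \<in> borel_measurable lebesgue"
  and AE_weight: "AE x in lebesgue. 0 < v x \<and> v x < \<infinity>"
  using weight by (auto simp: weight_def)

lemma weight_eq: "v x = c * h x"
  using mult[of 1 "fst x" 1 "snd x"] by simp

lemma const_pos: "c \<noteq> 0" and const_finite: "c \<noteq> top"
proof -
  have "ae_filter (lebesgue :: (real \<times> real) measure) \<noteq> bot"
    by (simp add: ae_filter_eq_bot_iff)
  from eventually_happens'[OF this AE_weight] obtain x where "0 < v x" "v x < \<infinity>"
    by blast
  then show "c \<noteq> 0" "c \<noteq> top"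
    using weight_eq[of x] by (auto simp: ennreal_top_mult split: if_splits)
qed

lemma multiplier_eq: "h x = v x / c"
  using const_pos const_finite
  by (simp add: weight_eq[of x] mult.commute ennreal_mult_divide_eq)

lemma multiplier_measurable [measurable]: "h \<in> borel_measurable lebesgue"
  unfolding multiplier_eq[abs_def] by measurable

lemma weight_pdiv: "off_axes t \<Longrightarrow> v x = v (pdiv x t) * h t"
  using mult[of "fst x / fst t" "fst t" "snd x / snd t" "snd t"]
  by (simp add: pdiv_def off_axes_def)

lemma multiplier_pdiv: "off_axes t \<Longrightarrow> h x = h (pdiv x t) * h t"
  by (simp add: multiplier_eq[of x] multiplier_eq[of "pdiv x t"] weight_pdiv[of t x]
      ennreal_divide_times divide_ennreal_def mult_ac)

text \<open>A homomorphism takes invertible values: \<open>h(1/t) h(t) = h(1,1) = 1\<close>.\<close>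

lemma multiplier_pos: "off_axes t \<Longrightarrow> h t \<noteq> 0"
  and multiplier_finite: "off_axes t \<Longrightarrow> h t \<noteq> top"
proof -
  have 1: "h (1, 1) = 1"
    unfolding multiplier_eq using const_pos const_finite by (intro ennreal_divide_self) (auto simp flip: less_top)
  show "h t \<noteq> 0" "h t \<noteq> top" if "off_axes t"
    using multiplier_pdiv[OF that, of "(1, 1)"]
    unfolding 1 by (auto simp: ennreal_mult_top split: if_splits)
qed

text \<open>This is why the essential supremum and infimum coincide. Points \<open>y\<close> with \<open>v y\<close> equal to \<open>0\<close> or \<open>\<infinity>\<close>,
  where the quotient cannot be cancelled, form a null set.\<close>

lemma AE_weight_ratio:
  assumes "off_axes t" shows "AE y in lebesgue. weight_ratio v t y = h t"
  using AE_weight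
proof eventually_elim
  case (elim y)
  have "v (fst t * fst y, snd t * snd y) = h t * v y"
    using mult[of "fst y" "fst t" "snd y" "snd t"] by (simp add: mult.commute)
  with elim show ?case
    using ennreal_mult_divide_eq[of "v y" "h t"] by (auto simp: weight_ratio_def less_top[symmetric])
qed

lemma weight_ratio_measurable:
  assumes "off_axes t" shows "weight_ratio v t \<in> borel_measurable lebesgue"
proof -
  let ?s = "(1 / fst t, 1 / snd t)"
  have "off_axes ?s"
    using assms by (simp add: off_axes_def)
  then have "(\<lambda>y. v (pdiv y ?s)) \<in> borel_measurable lebesgue"
    by (rule measurable_compose[OF pdiv_right_measurable weight_measurable])
  also have "(\<lambda>y. v (pdiv y ?s)) = (\<lambda>y. v (fst t * fst y, snd t * snd y))"
    by (auto simp: pdiv_def mult.commute[of "fst t"] mult.commute[of "snd t"])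
  finally have [measurable]: "(\<lambda>y. v (fst t * fst y, snd t * snd y)) \<in> borel_measurable lebesgue" .
  show ?thesis
    unfolding weight_ratio_def by measurable
qed

lemma esssup_weight_ratio:
  assumes "off_axes t" shows "esssup lebesgue (weight_ratio v t) = h t"
  using esssup_AE_cong[OF weight_ratio_measurable[OF assms] _ AE_weight_ratio[OF assms]]
  by (simp add: esssup_const)

lemma essinf_weight_ratio:
  assumes "off_axes t" shows "essinf lebesgue (weight_ratio v t) = h t"
  using weight_ratio_measurable[OF assms] Liminf_eq[OF AE_weight_ratio[OF assms]]
  by (simp add: essinf_def Liminf_const ae_filter_eq_bot_iff)

end

lemma dh_kernel_on_axes: "\<not> off_axes t \<Longrightarrow> dh_kernel \<alpha> \<phi> p t = 0"
  by (simp add: dh_kernel_def off_axes_def)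

lemma dh_kernel_measurable [measurable]:
  fixes \<phi> :: "real \<times> real \<Rightarrow> 'a::{real_normed_field, banach, second_countable_topology}"
  assumes [measurable]: "\<phi> \<in> borel_measurable lebesgue"
  shows "dh_kernel \<alpha> \<phi> p \<in> borel_measurable lebesgue"
  unfolding dh_kernel_def by measurable

lemma dh_integrand_measurable:
  fixes \<phi> :: "real \<times> real \<Rightarrow> 'a::{real_normed_field, banach, second_countable_topology}"
  assumes [measurable]: "\<phi> \<in> borel_measurable lebesgue" "f \<in> borel_measurable lebesgue"
    and x: "off_axes x"
  shows "dh_integrand \<alpha> \<phi> f x \<in> borel_measurable lebesgue"
proof -
  note [measurable] = measurable_compose[OF pdiv_left_measurable[OF x] assms(2)]
  show ?thesis
    unfolding dh_integrand_def pdiv_def[symmetric] by measurable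
qed

section \<open>The upper bound\<close>

context multiplicative_weight
begin

lemma A_sup_eq: "A_sup \<alpha> \<phi> p v = (\<integral>\<^sup>+t. dh_kernel \<alpha> \<phi> p t * epowr (h t) (1 / p) \<partial>lebesgue)"
  unfolding A_sup_def
  by (rule nn_integral_cong)
     (metis dh_kernel_on_axes esssup_weight_ratio mult_zero_left)

lemma A_inf_eq: "A_inf \<alpha> \<phi> p v = (\<integral>\<^sup>+t. dh_kernel \<alpha> \<phi> p t * epowr (h t) (1 / p) \<partial>lebesgue)"
  unfolding A_inf_def
  by (rule nn_integral_cong)
     (metis dh_kernel_on_axes essinf_weight_ratio mult_zero_left)

text \<open>The upper bound for the operator norm. Dilation by \<open>t\<close> multiplies the \<open>p\<close>-th power of the weighted
  norm by \<open>\<bar>t\<^sub>1 t\<^sub>2\<bar> h(t)\<close>. So with \<open>k\<close> the integrand of the constant \<open>A\<close>, the operator is the average,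
  with density \<open>k\<close>, of dilations renormalised to be isometries, and Minkowski's inequality gives the
  norm bound \<open>A\<close>. As the bound applies to the integral of the absolute values, it also yields absolute
  convergence almost everywhere.\<close>

lemma dh_bound_integral:
  fixes \<phi> :: "real \<times> real \<Rightarrow> 'a::{real_normed_field, banach, second_countable_topology}"
  assumes p: "1 < p" and \<phi>: "\<phi> \<in> borel_measurable lebesgue"
    and fin: "(\<integral>\<^sup>+t. dh_kernel \<alpha> \<phi> p t * epowr (h t) (1 / p) \<partial>lebesgue) < \<infinity>"
  shows "dh_bound \<alpha> \<phi> p v (\<integral>\<^sup>+t. dh_kernel \<alpha> \<phi> p t * epowr (h t) (1 / p) \<partial>lebesgue)"
  unfolding dh_bound_def
proof
  fix f :: "real \<times> real \<Rightarrow> 'a" assume "f \<in> wLp p v"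
  then have f: "f \<in> borel_measurable lebesgue" and f_fin: "wLp_norm p v f < \<infinity>"
    by (auto simp: wLp_def)
  note [measurable] = \<phi> f
  define k where "k t = dh_kernel \<alpha> \<phi> p t * epowr (h t) (1 / p)" for t
  define A where "A = (\<integral>\<^sup>+t. k t \<partial>lebesgue)"
  define D where "D = (\<integral>\<^sup>+x. ennreal (norm (f x) powr p) * v x \<partial>lebesgue)"
  define K where "K t = ennreal (norm (\<phi> t) / \<bar>fst t * snd t\<bar> powr (2 * \<alpha> + 2))" for t
  have D_fin: "D < \<infinity>"
    using f_fin unfolding wLp_norm_def D_def by (metis epowr_top infinity_ennreal_def less_top)
  have "(\<lambda>x. ennreal (norm (f x))) \<in> borel_measurable lebesgue"
    by measurable
  from completion_ex_borel_measurable[OF this] obtain g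
    where g [measurable]: "g \<in> borel_measurable borel"
      and "AE x in lborel. ennreal (norm (f x)) = g x"
    by auto
  then have fg: "AE x in lebesgue. g x = ennreal (norm (f x))"
    by (auto intro: AE_completion elim: eventually_mono)
  \<comment> \<open>Dilation by \<open>t\<close> multiplies the \<open>p\<close>-th power of the norm by the inverse of \<open>q t\<close>, so \<open>G\<close> is the
    renormalised dilation. Tonelli's theorem needs joint measurability of \<open>G\<close>, hence the Borel version
    \<open>g\<close> of \<open>norm f\<close>.\<close>
  define q where "q t = inverse (ennreal \<bar>fst t * snd t\<bar> * h t)" for t
  define G where "G x t = g (pdiv x t) * epowr (q t) (1 / p)" for x t
  have [measurable]: "k \<in> borel_measurable lebesgue" "q \<in> borel_measurable lebesgue"
    unfolding k_def q_def by measurable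
  have id: "(\<lambda>x. x) \<in> lebesgue \<rightarrow>\<^sub>M (borel :: (real \<times> real) measure)"
    by (intro measurable_lebesgue_borel) simp
  have [measurable]: "(\<lambda>z. pdiv (fst z) (snd z)) \<in> borel_measurable (lebesgue \<Otimes>\<^sub>M lebesgue)"
    by (intro pdiv_borel measurable_compose[OF measurable_fst id] measurable_compose[OF measurable_snd id])
  have G [measurable]: "case_prod G \<in> borel_measurable (lebesgue \<Otimes>\<^sub>M lebesgue)"
    unfolding G_def case_prod_beta by measurable
  have slice: "(\<integral>\<^sup>+x. epowr (G x t) p * v x \<partial>lebesgue) = D" if t: "off_axes t" for t
  proof -
    let ?F = "\<lambda>y. epowr (g y) p * v y"
    have "(\<integral>\<^sup>+x. epowr (G x t) p * v x \<partial>lebesgue) = (\<integral>\<^sup>+x. (q t * h t) * ?F (pdiv x t) \<partial>lebesgue)"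
    proof (rule nn_integral_cong)
      show "epowr (G x t) p * v x = (q t * h t) * ?F (pdiv x t)" for x
        using p by (simp add: G_def epowr_mult epowr_epowr weight_pdiv[OF t, of x] mult_ac)
    qed
    also have "\<dots> = (q t * h t) * (\<integral>\<^sup>+x. ?F (pdiv x t) \<partial>lebesgue)"
    proof (intro nn_integral_cmult)
      have "?F \<in> borel_measurable lebesgue" by measurable
      from measurable_compose[OF pdiv_right_measurable[OF t] this]
      show "(\<lambda>x. ?F (pdiv x t)) \<in> borel_measurable lebesgue" .
    qed
    also have "\<dots> = (q t * h t) * (ennreal \<bar>fst t * snd t\<bar> * (\<integral>\<^sup>+x. ?F x \<partial>lebesgue))"
      using t by (subst nn_integral_pdiv) auto
    also have "\<dots> = (q t * (ennreal \<bar>fst t * snd t\<bar> * h t)) * (\<integral>\<^sup>+x. ?F x \<partial>lebesgue)"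
      by (simp add: mult_ac)
    also have "q t * (ennreal \<bar>fst t * snd t\<bar> * h t) = 1"
    proof -
      have "ennreal \<bar>fst t * snd t\<bar> * h t \<noteq> 0" "ennreal \<bar>fst t * snd t\<bar> * h t \<noteq> top"
        using multiplier_pos[OF t] multiplier_finite[OF t] t
        by (auto simp: off_axes_def ennreal_mult_eq_top_iff)
      then show ?thesis
        unfolding q_def by (metis ennreal_divide_self divide_ennreal_def mult.commute less_top)
    qed
    also have "(\<integral>\<^sup>+x. ?F x \<partial>lebesgue) = D"
      unfolding D_def using fg
      by (intro nn_integral_cong_AE) (auto elim!: eventually_mono simp: epowr_ennreal)
    finally show ?thesis by simp
  qed
  define F where "F x = (\<integral>\<^sup>+t. k t * G x t \<partial>lebesgue)" for x
  have F_meas [measurable]: "F \<in> borel_measurable lebesgue"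
  proof -
    interpret sigma_finite_measure "lebesgue :: (real \<times> real) measure"
      by (rule sigma_finite_lebesgue)
    show ?thesis
      unfolding F_def by measurable
  qed
  have Minkowski: "(\<integral>\<^sup>+x. epowr (F x) p * v x \<partial>lebesgue) \<le> epowr A p * D"
    unfolding F_def A_def
  proof (rule Minkowski_nn_integral_powr[OF p sigma_finite_lebesgue sigma_finite_lebesgue G])
    show "AE t in lebesgue. (\<integral>\<^sup>+x. epowr (G x t) p * v x \<partial>lebesgue) \<le> D"
      using AE_off_axes by eventually_elim (simp add: slice)
  qed (use fin in \<open>auto simp: k_def\<close>)
  have kG: "k t * G x t = K t * g (pdiv x t)" if t: "off_axes t" for x t
  proof -
    let ?a = "\<bar>fst t * snd t\<bar>"
    obtain H where H: "h t = ennreal H" "0 < H"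
      using multiplier_pos[OF t] multiplier_finite[OF t] by (cases "h t") auto
    have a: "0 < ?a" using t by (simp add: off_axes_def)
    have "dh_kernel \<alpha> \<phi> p t * (epowr (h t) (1 / p) * epowr (q t) (1 / p)) = K t"
      using a H
      by (simp add: q_def K_def dh_kernel_def epowr_ennreal inverse_ennreal powr_mult powr_diff
          powr_divide inverse_eq_divide flip: ennreal_mult)
    then show ?thesis
      by (simp add: k_def G_def mult_ac flip: \<open>_ = K t\<close>)
  qed
  have F_eq: "F x = (\<integral>\<^sup>+t. ennreal (norm (dh_integrand \<alpha> \<phi> f x t)) \<partial>lebesgue)" if x: "off_axes x" for x
    unfolding F_def
  proof (rule nn_integral_cong_AE)
    show "AE t in lebesgue. k t * G x t = ennreal (norm (dh_integrand \<alpha> \<phi> f x t))"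
      using AE_pdiv_left[OF x fg] AE_off_axes
      by eventually_elim (simp add: kG K_def dh_integrand_def pdiv_def flip: ennreal_mult)
  qed
  have le_F: "ennreal (norm (dunkl_hausdorff \<alpha> \<phi> f x)) \<le> F x" if x: "off_axes x" for x
  proof (cases "F x < \<infinity>")
    case True
    then have "integrable lebesgue (dh_integrand \<alpha> \<phi> f x)"
      using x by (intro integrableI_bounded dh_integrand_measurable) (auto simp: F_eq \<phi> f)
    then show ?thesis
      unfolding dunkl_hausdorff_def F_eq[OF x] by (rule integral_norm_bound_ennreal)
  qed (simp add: not_less top_unique)
  have "epowr A p * D < \<infinity>"
    using fin D_fin by (simp add: A_def k_def ennreal_mult_less_top)
  with Minkowski have "(\<integral>\<^sup>+x. epowr (F x) p * v x \<partial>lebesgue) \<noteq> \<infinity>"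
    by (metis leD)
  then have "AE x in lebesgue. epowr (F x) p * v x \<noteq> \<infinity>"
    by (intro nn_integral_PInf_AE) auto
  then have conv: "AE x in lebesgue. integrable lebesgue (dh_integrand \<alpha> \<phi> f x)"
    using AE_weight AE_off_axes
  proof eventually_elim
    case (elim x)
    then have "F x < \<infinity>"
      by (auto simp: ennreal_mult_eq_top_iff less_top)
    then show ?case
      using elim by (intro integrableI_bounded dh_integrand_measurable) (auto simp: F_eq \<phi> f)
  qed
  have "(\<integral>\<^sup>+x. ennreal (norm (dunkl_hausdorff \<alpha> \<phi> f x) powr p) * v x \<partial>lebesgue)
      \<le> (\<integral>\<^sup>+x. epowr (F x) p * v x \<partial>lebesgue)"
  proof (rule nn_integral_mono_AE)
    show "AE x in lebesgue. ennreal (norm (dunkl_hausdorff \<alpha> \<phi> f x) powr p) * v x \<le> epowr (F x) p * v x"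
      using AE_off_axes
    proof eventually_elim
      case (elim x)
      from epowr_mono[OF le_F[OF elim], of p] p show ?case
        by (intro mult_right_mono) (simp_all add: epowr_ennreal)
    qed
  qed
  also note Minkowski
  finally have "wLp_norm p v (dunkl_hausdorff \<alpha> \<phi> f) \<le> epowr (epowr A p * D) (1 / p)"
    unfolding wLp_norm_def using p by (intro epowr_mono) auto
  also have "\<dots> = A * wLp_norm p v f"
    using p by (simp add: epowr_mult epowr_epowr wLp_norm_def D_def)
  finally show "(AE x in lebesgue. integrable lebesgue (dh_integrand \<alpha> \<phi> f x)) \<and>
      wLp_norm p v (dunkl_hausdorff \<alpha> \<phi> f)
        \<le> (\<integral>\<^sup>+t. dh_kernel \<alpha> \<phi> p t * epowr (h t) (1 / p) \<partial>lebesgue) * wLp_norm p v f"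
    using conv by (simp add: A_def k_def)
qed

end

section \<open>Folner sets\<close>

text \<open>In logarithmic coordinates these are the squares of side \<open>2 s\<close> around the origin, once for each
  combination of signs. They are Folner sets of the group off the axes: the part of
  the square within a bounded distance of its boundary is a proportion that tends to \<open>0\<close> as \<open>s\<close> grows.\<close>

definition log_box :: "real \<Rightarrow> (real \<times> real) set" where
  "log_box s = {x. off_axes x \<and> \<bar>ln \<bar>fst x\<bar>\<bar> \<le> s \<and> \<bar>ln \<bar>snd x\<bar>\<bar> \<le> s}"

lemma log_box_off_axes: "x \<in> log_box s \<Longrightarrow> off_axes x"
  by (simp add: log_box_def)

lemma log_box_mono: "r \<le> s \<Longrightarrow> log_box r \<subseteq> log_box s"
  by (auto simp: log_box_def)

lemma pdiv_log_box:
  assumes "x \<in> log_box (s - r)" "t \<in> log_box r"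
  shows "pdiv x t \<in> log_box s"
proof -
  have "\<bar>ln \<bar>a / b\<bar>\<bar> \<le> s" if "a \<noteq> 0" "b \<noteq> 0" "\<bar>ln \<bar>a\<bar>\<bar> \<le> s - r" "\<bar>ln \<bar>b\<bar>\<bar> \<le> r" for a b :: real
  proof -
    have "ln \<bar>a / b\<bar> = ln \<bar>a\<bar> - ln \<bar>b\<bar>"
      using that(1,2) by (simp add: abs_divide ln_div)
    then show ?thesis
      using that(3,4) abs_triangle_ineq4[of "ln \<bar>a\<bar>" "ln \<bar>b\<bar>"] by linarith
  qed
  then show ?thesis
    using assms by (simp add: log_box_def pdiv_def off_axes_def)
qed

lemma log_box_measurable [measurable]: "log_box s \<in> sets lebesgue"
proof -
  have fs [measurable]: "fst \<in> borel_measurable (borel :: (real \<times> real) measure)"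
      "snd \<in> borel_measurable (borel :: (real \<times> real) measure)"
    by (auto intro!: borel_measurable_continuous_onI continuous_intros)
  have "Measurable.pred borel (\<lambda>x::real\<times>real. x \<in> log_box s)"
    unfolding log_box_def off_axes_def mem_Collect_eq by measurable
  then have "log_box s \<in> sets borel"
    by (simp add: pred_def)
  then show ?thesis
    by simp
qed

text \<open>The Haar measure \<open>dy / \<bar>y\<bar>\<close> becomes Lebesgue measure under \<open>ln \<bar>y\<bar>\<close>, on each of the two half-lines.\<close>

lemma nn_integral_log_interval:
  assumes "0 \<le> s"
  shows "(\<integral>\<^sup>+y. ennreal (1 / \<bar>y\<bar>) * indicator {y. y \<noteq> 0 \<and> \<bar>ln \<bar>y\<bar>\<bar> \<le> s} y \<partial>lborel) = ennreal (4 * s)"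
proof -
  let ?I = "{exp (- s)..exp s}"
  let ?F = "\<lambda>y::real. ennreal (1 / \<bar>y\<bar>) * indicator ?I y"
  have I: "y \<in> ?I \<longleftrightarrow> 0 < y \<and> \<bar>ln y\<bar> \<le> s" for y
  proof (cases "0 < y")
    case True
    then show ?thesis
      using exp_le_cancel_iff[of "- s" "ln y"] exp_le_cancel_iff[of "ln y" s] by auto
  next
    case False
    then show ?thesis
      using exp_gt_zero[of "- s"] by (auto simp del: exp_gt_zero)
  qed
  have half: "(\<integral>\<^sup>+y. ?F y \<partial>lborel) = ennreal (2 * s)"
  proof -
    have "(\<integral>\<^sup>+y. ?F y \<partial>lborel) = ennreal (ln (exp s) - ln (exp (- s)))"
    proof (rule nn_integral_FTC_Icc)
      show "DERIV ln y :> 1 / \<bar>y\<bar>" if "y \<in> ?I" for y :: real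
        using that unfolding I by (auto intro!: derivative_eq_intros)
    qed (use assms in auto)
    then show ?thesis by simp
  qed
  have "(\<integral>\<^sup>+y. ennreal (1 / \<bar>y\<bar>) * indicator {y. y \<noteq> 0 \<and> \<bar>ln \<bar>y\<bar>\<bar> \<le> s} y \<partial>lborel)
      = (\<integral>\<^sup>+y. ?F y + ?F (0 + (-1) * y) \<partial>lborel)"
  proof (rule nn_integral_cong)
    fix y :: real
    show "ennreal (1 / \<bar>y\<bar>) * indicator {y. y \<noteq> 0 \<and> \<bar>ln \<bar>y\<bar>\<bar> \<le> s} y = ?F y + ?F (0 + (-1) * y)"
      using I[of y] I[of "- y"]
      by (cases y "0 :: real" rule: linorder_cases) (auto simp: indicator_def)
  qed
  also have "\<dots> = (\<integral>\<^sup>+y. ?F y \<partial>lborel) + (\<integral>\<^sup>+y. ?F (0 + (-1) * y) \<partial>lborel)"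
    by (intro nn_integral_add) auto
  also have "(\<integral>\<^sup>+y. ?F (0 + (-1) * y) \<partial>lborel) = (\<integral>\<^sup>+y. ?F y \<partial>lborel)"
    using nn_integral_real_affine[of ?F "-1" 0] by simp
  finally show ?thesis
    using assms unfolding half by (simp flip: ennreal_plus)
qed

lemma nn_integral_log_box:
  assumes "0 \<le> s"
  shows "(\<integral>\<^sup>+x. ennreal (1 / \<bar>fst x * snd x\<bar>) * indicator (log_box s) x \<partial>lebesgue) = ennreal ((4 * s)\<^sup>2)"
proof -
  let ?J = "\<lambda>y. ennreal (1 / \<bar>y\<bar>) * indicator {y. y \<noteq> 0 \<and> \<bar>ln \<bar>y\<bar>\<bar> \<le> s} y"
  have [measurable]: "?J \<in> borel_measurable lborel" by measurable
  have "(\<integral>\<^sup>+x. ennreal (1 / \<bar>fst x * snd x\<bar>) * indicator (log_box s) x \<partial>lebesgue)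
      = (\<integral>\<^sup>+x. ?J (fst x) * ?J (snd x) \<partial>(lborel \<Otimes>\<^sub>M lborel))"
    unfolding nn_integral_completion lborel_prod
    by (intro nn_integral_cong)
      (auto simp: indicator_def log_box_def off_axes_def abs_mult simp flip: ennreal_mult)
  also have "\<dots> = (\<integral>\<^sup>+y. \<integral>\<^sup>+z. ?J y * ?J z \<partial>lborel \<partial>lborel)"
    by (subst lborel.nn_integral_fst[symmetric]) auto
  also have "\<dots> = (\<integral>\<^sup>+y. ?J y \<partial>lborel) * (\<integral>\<^sup>+z. ?J z \<partial>lborel)"
    by (simp add: nn_integral_cmult nn_integral_multc)
  also have "\<dots> = ennreal ((4 * s)\<^sup>2)"
    unfolding nn_integral_log_interval[OF assms]
    using assms by (simp add: power2_eq_square flip: ennreal_mult)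
  finally show ?thesis .
qed

lemma SUP_log_box:
  assumes "\<And>t. \<not> off_axes t \<Longrightarrow> k t = (0 :: ennreal)"
  shows "(SUP n::nat. k t * indicator (log_box (real n)) t) = k t"
proof (rule antisym)
  show "(SUP n::nat. k t * indicator (log_box (real n)) t) \<le> k t"
    by (intro SUP_least) (auto simp: indicator_def)
  show "k t \<le> (SUP n::nat. k t * indicator (log_box (real n)) t)"
  proof (cases "off_axes t")
    case True
    obtain n :: nat where "max \<bar>ln \<bar>fst t\<bar>\<bar> \<bar>ln \<bar>snd t\<bar>\<bar> \<le> real n"
      using real_arch_simple by blast
    with True have "t \<in> log_box (real n)"
      by (simp add: log_box_def)
    then show ?thesis
      by (intro SUP_upper2[of n]) auto
  qed (simp add: assms)
qed

section \<open>The lower bound\<close>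

context multiplicative_weight
begin

text \<open>The function whose dilations are multiples of itself and for which \<open>(extremal p)\<^sup>p v\<close> is a multiple of
  the Haar density \<open>1 / \<bar>x\<^sub>1 x\<^sub>2\<bar>\<close>. It would be an exact eigenfunction of the operator, with the operator
  norm as eigenvalue, but it is not in the weighted space and has to be truncated.\<close>

definition extremal :: "real \<Rightarrow> real \<times> real \<Rightarrow> real" where
  "extremal p x = (enn2real (h x) * \<bar>fst x * snd x\<bar>) powr (- 1 / p)"

lemma extremal_nonneg [simp]: "0 \<le> extremal p x"
  by (simp add: extremal_def)

lemma extremal_measurable [measurable]: "extremal p \<in> borel_measurable lebesgue"
  unfolding extremal_def by measurable

lemma real_multiplier:
  assumes "off_axes t" obtains H where "h t = ennreal H" "0 < H"
  using multiplier_pos[OF assms] multiplier_finite[OF assms] by (cases "h t") auto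

lemma extremal_pdiv:
  assumes x: "off_axes x" and t: "off_axes t"
  shows "extremal p (pdiv x t) = extremal p x * (enn2real (h t) * \<bar>fst t * snd t\<bar>) powr (1 / p)"
proof -
  have "off_axes (pdiv x t)"
    using x t by (simp add: off_axes_def pdiv_def)
  then obtain H where H: "h (pdiv x t) = ennreal H" "0 < H"
    by (rule real_multiplier)
  obtain T where T: "h t = ennreal T" "0 < T"
    using t by (rule real_multiplier)
  have "h x = ennreal (H * T)"
    using multiplier_pdiv[OF t, of x] H T by (simp add: ennreal_mult)
  then have hx: "enn2real (h x) = H * T"
    using H T by simp
  let ?x = "\<bar>fst x * snd x\<bar>" and ?t = "\<bar>fst t * snd t\<bar>"
  have pos: "0 < ?x" "0 < ?t"
    using x t by (auto simp: off_axes_def)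
  have "\<bar>fst (pdiv x t) * snd (pdiv x t)\<bar> = ?x / ?t"
    by (simp add: pdiv_def abs_mult)
  moreover have "H * (?x / ?t) = H * T * ?x / (T * ?t)"
    using T by simp
  ultimately have "extremal p (pdiv x t) = (H * T * ?x / (T * ?t)) powr (- 1 / p)"
    using H by (simp only: extremal_def) simp
  also have "\<dots> = (H * T * ?x) powr (- 1 / p) * (T * ?t) powr (1 / p)"
  proof -
    have "(u / w) powr (- 1 / p) = u powr (- 1 / p) * w powr (1 / p)" if "0 < u" "0 < w" for u w :: real
      using that by (simp add: powr_divide powr_minus_divide)
    from this[of "H * T * ?x" "T * ?t"] show ?thesis
      using H(2) T(2) pos by simp
  qed
  finally show ?thesis
    using hx T by (simp add: extremal_def)
qed

lemma nn_integral_extremal: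
  assumes "1 < p" "0 \<le> s"
  shows "(\<integral>\<^sup>+x. ennreal (extremal p x powr p) * indicator (log_box s) x * v x \<partial>lebesgue)
    = c * ennreal ((4 * s)\<^sup>2)"
proof -
  have pointwise: "ennreal (extremal p x powr p) * indicator (log_box s) x * v x
      = c * (ennreal (1 / \<bar>fst x * snd x\<bar>) * indicator (log_box s) x)" for x
  proof (cases "x \<in> log_box s")
    case True
    then have x: "off_axes x" by (rule log_box_off_axes)
    then obtain H where H: "h x = ennreal H" "0 < H"
      by (rule real_multiplier)
    have pos: "0 < \<bar>fst x * snd x\<bar>"
      using x by (simp add: off_axes_def)
    have "extremal p x powr p = (H * \<bar>fst x * snd x\<bar>) powr (- 1)"
      using assms H unfolding extremal_def powr_powr by simp
    also have "\<dots> = 1 / (H * \<bar>fst x * snd x\<bar>)"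
      using H pos by (simp add: powr_minus_divide)
    finally have "extremal p x powr p = 1 / (H * \<bar>fst x * snd x\<bar>)" .
    then have *: "ennreal (extremal p x powr p) * h x = ennreal (1 / \<bar>fst x * snd x\<bar>)"
      using H by (simp flip: ennreal_mult)
    show ?thesis
      using True by (simp add: weight_eq[of x] mult_ac flip: *)
  qed simp
  show ?thesis
    unfolding pointwise nn_integral_log_box[OF assms(2), symmetric]
    by (intro nn_integral_cmult) measurable
qed

text \<open>The lower bound at finite scale: test the operator on \<open>extremal p\<close> truncated to \<open>log_box s\<close>. For
  \<open>x \<in> log_box (s - r)\<close> and \<open>t \<in> log_box r\<close> the point \<open>x / t\<close> is still inside \<open>log_box s\<close>, so at \<open>x\<close> the
  truncation loses nothing of the part of the eigenvalue integral that comes from \<open>log_box r\<close>.\<close>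

lemma dh_bound_truncated:
  fixes \<phi> :: "real \<times> real \<Rightarrow> 'a::{real_normed_field, banach, second_countable_topology}"
  assumes p: "1 < p" and \<phi>: "\<phi> \<in> borel_measurable lebesgue"
    and C: "dh_bound \<alpha> \<phi> p v C" and r: "0 \<le> r" "r < s"
  shows "(\<integral>\<^sup>+t. dh_kernel \<alpha> \<phi> p t * epowr (h t) (1 / p) * indicator (log_box r) t \<partial>lebesgue)
      * epowr (c * ennreal ((4 * (s - r))\<^sup>2)) (1 / p) \<le> C * epowr (c * ennreal ((4 * s)\<^sup>2)) (1 / p)"
proof -
  note [measurable] = \<phi>
  define k where "k t = dh_kernel \<alpha> \<phi> p t * epowr (h t) (1 / p)" for t
  define A where "A = (\<integral>\<^sup>+t. k t * indicator (log_box r) t \<partial>lebesgue)"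
  have [measurable]: "k \<in> borel_measurable lebesgue"
    unfolding k_def by measurable
  define f :: "real \<times> real \<Rightarrow> 'a" where
    "f x = of_real (indicator (log_box s) x * extremal p x)" for x
  have f_meas: "f \<in> borel_measurable lebesgue"
    unfolding f_def by measurable
  have norm_f: "wLp_norm p v f = epowr (c * ennreal ((4 * s)\<^sup>2)) (1 / p)"
    unfolding wLp_norm_def
  proof (rule arg_cong[where f = "\<lambda>I. epowr I (1 / p)"])
    have "(\<integral>\<^sup>+x. ennreal (norm (f x) powr p) * v x \<partial>lebesgue)
        = (\<integral>\<^sup>+x. ennreal (extremal p x powr p) * indicator (log_box s) x * v x \<partial>lebesgue)"
      by (intro nn_integral_cong) (auto simp: f_def indicator_def)
    also have "\<dots> = c * ennreal ((4 * s)\<^sup>2)"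
      using p r by (intro nn_integral_extremal) auto
    finally show "(\<integral>\<^sup>+x. ennreal (norm (f x) powr p) * v x \<partial>lebesgue) = c * ennreal ((4 * s)\<^sup>2)" .
  qed
  have "f \<in> wLp p v"
    unfolding wLp_def using const_finite
    by (simp add: f_meas norm_f ennreal_mult_less_top less_top)
  with C have conv: "AE x in lebesgue. integrable lebesgue (dh_integrand \<alpha> \<phi> f x)"
    and le: "wLp_norm p v (dunkl_hausdorff \<alpha> \<phi> f) \<le> C * wLp_norm p v f"
    unfolding dh_bound_def by auto
  have lower: "ennreal (extremal p x) * A \<le> ennreal (norm (dunkl_hausdorff \<alpha> \<phi> f x))"
    if int: "integrable lebesgue (dh_integrand \<alpha> \<phi> f x)" and x: "x \<in> log_box (s - r)" for x
  proof -
    define J where "J t = norm (\<phi> t) / \<bar>fst t * snd t\<bar> powr (2 * \<alpha> + 2)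
        * (indicator (log_box s) (pdiv x t) * extremal p (pdiv x t))" for t
    have J_nonneg: "0 \<le> J t" for t
      by (simp add: J_def)
    have J: "dh_integrand \<alpha> \<phi> f x t = of_real (J t)" for t
      by (simp add: dh_integrand_def J_def f_def pdiv_def scaleR_conv_of_real)
    have "integrable lebesgue (\<lambda>t. norm (dh_integrand \<alpha> \<phi> f x t))"
      using int by (rule integrable_norm)
    then have intJ: "integrable lebesgue J"
      unfolding J using J_nonneg by simp
    have "ennreal (extremal p x) * A
        = (\<integral>\<^sup>+t. ennreal (extremal p x) * (k t * indicator (log_box r) t) \<partial>lebesgue)"
      unfolding A_def by (rule nn_integral_cmult[symmetric]) measurable
    also have "\<dots> \<le> (\<integral>\<^sup>+t. ennreal (J t) \<partial>lebesgue)"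
    proof (rule nn_integral_mono)
      fix t
      show "ennreal (extremal p x) * (k t * indicator (log_box r) t) \<le> ennreal (J t)"
      proof (cases "t \<in> log_box r")
        case True
        then have t: "off_axes t" by (rule log_box_off_axes)
        then obtain H where H: "h t = ennreal H" "0 < H"
          by (rule real_multiplier)
        have pos: "0 < \<bar>fst t * snd t\<bar>"
          using t by (simp add: off_axes_def)
        have "J t = extremal p x * (norm (\<phi> t) / \<bar>fst t * snd t\<bar> powr (2 * \<alpha> + 2 - 1 / p) * H powr (1 / p))"
          using pdiv_log_box[OF x True] H pos
          by (simp add: J_def extremal_pdiv[OF log_box_off_axes[OF x] t] powr_mult powr_diff)
        then show ?thesis
          using True H by (simp add: k_def dh_kernel_def epowr_ennreal flip: ennreal_mult)
      qed simp
    qed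
    also have "\<dots> = ennreal (\<integral>t. J t \<partial>lebesgue)"
      using intJ J_nonneg by (intro nn_integral_eq_integral) auto
    also have "(\<integral>t. J t \<partial>lebesgue) = norm (dunkl_hausdorff \<alpha> \<phi> f x)"
      using intJ J_nonneg by (simp add: dunkl_hausdorff_def J Bochner_Integration.integral_nonneg)
    finally show ?thesis .
  qed
  have "epowr A p * (c * ennreal ((4 * (s - r))\<^sup>2))
      = (\<integral>\<^sup>+x. epowr A p * (ennreal (extremal p x powr p) * indicator (log_box (s - r)) x * v x) \<partial>lebesgue)"
    using p r by (subst nn_integral_cmult) (simp_all add: nn_integral_extremal)
  also have "\<dots> \<le> (\<integral>\<^sup>+x. ennreal (norm (dunkl_hausdorff \<alpha> \<phi> f x) powr p) * v x \<partial>lebesgue)"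
      (is "_ \<le> (\<integral>\<^sup>+x. ?R x \<partial>lebesgue)")
  proof (rule nn_integral_mono_AE, rule eventually_mono[OF conv])
    fix x assume int: "integrable lebesgue (dh_integrand \<alpha> \<phi> f x)"
    show "epowr A p * (ennreal (extremal p x powr p) * indicator (log_box (s - r)) x * v x) \<le> ?R x"
    proof (cases "x \<in> log_box (s - r)")
      case True
      have "epowr (ennreal (extremal p x) * A) p \<le> epowr (ennreal (norm (dunkl_hausdorff \<alpha> \<phi> f x))) p"
        using p by (intro epowr_mono lower int True) auto
      then have "epowr A p * ennreal (extremal p x powr p)
          \<le> ennreal (norm (dunkl_hausdorff \<alpha> \<phi> f x) powr p)"
        by (simp add: epowr_mult epowr_ennreal mult.commute)
      from mult_right_mono[OF this, of "v x"] True show ?thesis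
        by (simp add: mult.assoc)
    qed simp
  qed
  finally have "epowr (epowr A p * (c * ennreal ((4 * (s - r))\<^sup>2))) (1 / p)
      \<le> wLp_norm p v (dunkl_hausdorff \<alpha> \<phi> f)"
    unfolding wLp_norm_def using p by (intro epowr_mono) auto
  also note le
  also have "epowr (epowr A p * D) (1 / p) = A * epowr D (1 / p)" for D
    using p by (simp add: epowr_mult epowr_epowr)
  finally show ?thesis
    by (simp only: norm_f A_def k_def)
qed

text \<open>Letting \<open>s\<close> tend to infinity first, the ratio of the two Haar measures tends to \<open>1\<close> and leaves the
  integral over \<open>log_box r\<close>; these integrals increase to the full one. If the full integral is infinite, this
  shows that there is no finite bound.\<close>

lemma integral_le_dh_bound:
  fixes \<phi> :: "real \<times> real \<Rightarrow> 'a::{real_normed_field, banach, second_countable_topology}"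
  assumes p: "1 < p" and \<phi>: "\<phi> \<in> borel_measurable lebesgue"
    and C: "dh_bound \<alpha> \<phi> p v C" "C < \<infinity>"
  shows "(\<integral>\<^sup>+t. dh_kernel \<alpha> \<phi> p t * epowr (h t) (1 / p) \<partial>lebesgue) \<le> C"
proof -
  note [measurable] = \<phi>
  define k where "k t = dh_kernel \<alpha> \<phi> p t * epowr (h t) (1 / p)" for t
  have [measurable]: "k \<in> borel_measurable lebesgue"
    unfolding k_def by measurable
  have truncated: "(\<integral>\<^sup>+t. k t * indicator (log_box r) t \<partial>lebesgue) \<le> C" if r: "0 \<le> r" for r
  proof -
    define A where "A = (\<integral>\<^sup>+t. k t * indicator (log_box r) t \<partial>lebesgue)"
    \<comment> \<open>The ratio of the norms of the extremal function on \<open>log_box (s - r)\<close> and on \<open>log_box s\<close>.\<close>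
    define \<theta> where "\<theta> s = ((1 - r / s)\<^sup>2) powr (1 / p)" for s
    have scaled: "A * ennreal (\<theta> s) \<le> C" if s: "r < s" for s
    proof -
      let ?D = "epowr (c * ennreal ((4 * s)\<^sup>2)) (1 / p)"
      have "(4 * (s - r))\<^sup>2 = (4 * s)\<^sup>2 * (1 - r / s)\<^sup>2"
        using r s by (simp add: field_simps power2_eq_square)
      then have "epowr (c * ennreal ((4 * (s - r))\<^sup>2)) (1 / p) = ?D * ennreal (\<theta> s)"
        by (simp add: \<theta>_def ennreal_mult epowr_mult epowr_ennreal mult.assoc)
      with dh_bound_truncated[OF p \<phi> C(1) r s]
      have "?D * (A * ennreal (\<theta> s)) \<le> ?D * C"
        by (simp add: A_def k_def mult_ac)
      moreover have "?D \<noteq> 0" "?D \<noteq> top"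
        using r s const_pos const_finite by (auto simp: ennreal_mult_eq_top_iff)
      ultimately show ?thesis
        by (simp add: ennreal_mult_le_mult_iff)
    qed
    obtain b where b: "C = ennreal b" "0 \<le> b"
      using C(2) by (cases C) auto
    have "A \<le> C"
    proof (cases A)
      case (real a)
      have "((\<lambda>s. 1 - r / s) \<longlongrightarrow> 1 - 0) at_top"
        by (intro tendsto_intros tendsto_divide_0[OF tendsto_const] filterlim_at_top_imp_at_infinity filterlim_ident)
      then have "((\<lambda>s. a * \<theta> s) \<longlongrightarrow> a * ((1 - 0)\<^sup>2) powr (1 / p)) at_top"
        unfolding \<theta>_def by (intro tendsto_mult tendsto_const tendsto_powr tendsto_power) auto
      moreover have "eventually (\<lambda>s. a * \<theta> s \<le> b) at_top"
        using eventually_gt_at_top[of r]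
      proof eventually_elim
        case (elim s)
        with scaled[of s] real b show ?case
          by (simp add: \<theta>_def flip: ennreal_mult)
      qed
      ultimately have "a * ((1 - 0)\<^sup>2) powr (1 / p) \<le> b"
        by (rule tendsto_upperbound) simp
      then show ?thesis
        using real b by (simp add: ennreal_leI)
    next
      case top
      have "0 < \<theta> (r + 1)"
        using r by (simp add: \<theta>_def)
      then show ?thesis
        using scaled[of "r + 1"] top C(2) by (simp add: ennreal_top_mult)
    qed
    then show ?thesis
      by (simp add: A_def)
  qed
  have "(\<integral>\<^sup>+t. k t \<partial>lebesgue) = (\<integral>\<^sup>+t. (SUP n::nat. k t * indicator (log_box (real n)) t) \<partial>lebesgue)"
    by (subst SUP_log_box) (simp_all add: k_def dh_kernel_on_axes)
  also have "\<dots> = (SUP n::nat. \<integral>\<^sup>+t. k t * indicator (log_box (real n)) t \<partial>lebesgue)"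
  proof (rule nn_integral_monotone_convergence_SUP)
    show "incseq (\<lambda>n t. k t * indicator (log_box (real n)) t)"
    proof (intro incseq_SucI le_funI mult_left_mono)
      show "indicator (log_box (real n)) t \<le> (indicator (log_box (real (Suc n))) t :: ennreal)" for n t
        using log_box_mono[of "real n" "real (Suc n)"] by (auto simp: indicator_def)
    qed simp
  qed measurable
  also have "\<dots> \<le> C"
    by (intro SUP_least truncated) simp
  finally show ?thesis
    by (simp add: k_def)
qed

end

section \<open>The operator norm\<close>

theorem corollary3p5:
  fixes p \<alpha> :: real
    and v h :: "real \<times> real \<Rightarrow> ennreal"
    and \<phi> :: "real \<times> real \<Rightarrow> 'a::{real_normed_field, banach, second_countable_topology}"
  assumes "1 < p"
    and "weight v"
    and "integrable lebesgue \<phi>"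
    and "\<And>x1 x2 y1 y2. v (x1 * y1, x2 * y2) = v (x1, x2) * h (y1, y2)"
  shows "A_sup \<alpha> \<phi> p v = A_inf \<alpha> \<phi> p v \<and>
    dh_opnorm \<alpha> \<phi> p v = (\<integral>\<^sup>+t. dh_kernel \<alpha> \<phi> p t * epowr (h t) (1 / p) \<partial>lebesgue)"
proof -
  interpret multiplicative_weight v h
    by unfold_locales (fact assms)+
  let ?A = "\<integral>\<^sup>+t. dh_kernel \<alpha> \<phi> p t * epowr (h t) (1 / p) \<partial>lebesgue"
  have \<phi>: "\<phi> \<in> borel_measurable lebesgue"
    using assms(3) by (rule borel_measurable_integrable)
  have "dh_opnorm \<alpha> \<phi> p v = ?A"
    unfolding dh_opnorm_def
  proof (rule antisym)
    show "?A \<le> Inf {C. C < \<infinity> \<and> dh_bound \<alpha> \<phi> p v C}"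
      using integral_le_dh_bound[OF assms(1) \<phi>] by (intro Inf_greatest) auto
    show "Inf {C. C < \<infinity> \<and> dh_bound \<alpha> \<phi> p v C} \<le> ?A"
    proof (cases "?A < \<infinity>")
      case True
      then show ?thesis
        using dh_bound_integral[OF assms(1) \<phi> True] by (intro Inf_lower) auto
    qed (simp add: not_less top_unique)
  qed
  then show ?thesis
    by (simp only: A_sup_eq A_inf_eq)
qed

end
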